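(* Let $\{f_0, f_1, f_2, f_3, \dots\}$ be the Fibonacci numbers, let $n \in \mathbb{N}$, and let $n = f_{i_1} + f_{i_2} + \cdots + f_{i_r}$ be the Zeckendorf representation of $n$. Then the out-degree of $v_n$ in the infinite Jaco graph $J_\infty(1)$ is $$d^+(v_n) = f_{i_1-1} + f_{i_2-1} + \cdots + f_{i_r-1}.$$
   Context: Here $\mathbb{N} = \{1,2,3,\dots\}$. The infinite Jaco graph $J_\infty(1)$ is the directed graph with vertex set $\{v_i : i \in \mathbb{N}\}$ in which all arcs are of the form $(v_i,v_j)$ (from $v_i$ to $v_j$) with $i<j$, and for $i<j$ the arc $(v_i,v_j)$ is present if and only if $2i - d^-(v_i) \geq j$, where $d^-(v_i)$ is the in-degree of $v_i$ in $J_\infty(1)$ (this defines the arcs recursively on $i$). $d^+(v_i)$ denotes the out-degree of $v_i$ in $J_\infty(1)$, so $d^+(v_i) = i - d^-(v_i)$. Fibonacci numbers: $f_0=0$, $f_1=1$, $f_{k+2}=f_{k+1}+f_k$ (so $f_2=1$, $f_3=2$, $f_4=3$). The Zeckendorf representation of $n\ge 1$ is the unique expression $n = f_{i_1}+\cdots+f_{i_r}$ with $r \ge 1$, $i_r \ge 2$ and $i_s \ge i_{s+1}+2$ for $1\le s<r$. *)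

theory Defs
  imports "Graph_Theory.Digraph" "HOL-Number_Theory.Fib"
begin

context
  notes conj_cong [fundef_cong]
begin

text \<open>
  The arcs into \<open>v\<^sub>j\<close> come from vertices \<open>v\<^sub>i\<close> with \<open>i < j\<close>, and whether such an arc is present
  depends only on the in-degree of \<open>v\<^sub>i\<close>. The in-degrees are therefore determined by recursion;
  lemma \<open>in_degree_jaco\<close> below shows that the numbers defined here are the in-degrees of the
  graph. The condition \<open>2i - d\<^sup>-(v\<^sub>i) \<ge> j\<close> is written without subtraction.
\<close>
fun jaco_indeg :: "nat \<Rightarrow> nat" where
  "jaco_indeg j = card {i. 1 \<le> i \<and> i < j \<and> j + jaco_indeg i \<le> 2 * i}"

end

declare jaco_indeg.simps [simp del]

text \<open>The vertex \<open>v\<^sub>i\<close> is represented by its index \<open>i \<ge> 1\<close>.\<close>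
definition jaco :: "(nat, nat \<times> nat) pre_digraph" where
  "jaco = \<lparr> verts = {1..},
            arcs = {(i, j). 1 \<le> i \<and> i < j \<and> j + jaco_indeg i \<le> 2 * i},
            tail = fst, head = snd \<rparr>"

lemma wf_digraph_jaco: "wf_digraph jaco"
  by unfold_locales (auto simp: jaco_def)

lemma in_degree_jaco: "in_degree jaco j = jaco_indeg j"
proof -
  have "in_arcs jaco j = (\<lambda>i. (i, j)) ` {i. 1 \<le> i \<and> i < j \<and> j + jaco_indeg i \<le> 2 * i}"
    by (auto simp: in_arcs_def jaco_def)
  then have "in_degree jaco j = card {i. 1 \<le> i \<and> i < j \<and> j + jaco_indeg i \<le> 2 * i}"
    by (simp add: in_degree_def card_image inj_on_def)
  then show ?thesis
    by (simp add: jaco_indeg.simps [of j])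
qed

text \<open>The defining property of the infinite Jaco graph, with the subtraction in the integers.\<close>
lemma jaco_arc_iff:
  "(i, j) \<in> arcs jaco \<longleftrightarrow>
     1 \<le> i \<and> i < j \<and> 2 * int i - int (in_degree jaco i) \<ge> int j"
  unfolding in_degree_jaco by (auto simp: jaco_def)

text \<open>\<open>n = f\<^bsub>i 1\<^esub> + \<dots> + f\<^bsub>i r\<^esub>\<close> is the Zeckendorf representation of \<open>n\<close>; the values of \<open>i\<close>
  outside \<open>{1..r}\<close> are irrelevant.\<close>
definition zeckendorf_rep :: "nat \<Rightarrow> nat \<Rightarrow> (nat \<Rightarrow> nat) \<Rightarrow> bool" where
  "zeckendorf_rep n r i \<longleftrightarrow>
     r \<ge> 1 \<and> i r \<ge> 2 \<and> (\<forall>s. 1 \<le> s \<and> s < r \<longrightarrow> i s \<ge> i (s + 1) + 2) \<and>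
     n = (\<Sum>s = 1..r. fib (i s))"

end

theory Submission
  imports Defs
begin

text \<open>
  Let \<open>d n\<close> be the out-degree of \<open>v\<^sub>n\<close>, with \<open>d 0 = 0\<close>, and let \<open>U k = k + d k\<close>. Counting the
  vertices before \<open>v\<^sub>n\<close> from which there is no arc to \<open>v\<^sub>n\<close> shows that \<open>d n\<close> is the number of
  \<open>k < n\<close> with \<open>U k < n\<close>. Hence \<open>d\<close> is monotone and \<open>U\<close> strictly monotone, so that
  \<open>d (U k) = k\<close> and \<open>d (U k + 1) = k + 1\<close>. If \<open>n\<close> is a sum of non-consecutive Fibonacci numbers
  \<open>f\<^bsub>j\<^esub>\<close> with \<open>j \<ge> 3\<close>, then by induction \<open>n = U m\<close> for the shifted sum \<open>m\<close> of the \<open>f\<^bsub>j-1\<^esub>\<close>, and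
  \<open>d n = m\<close>. If \<open>f\<^sub>2 = 1\<close> occurs, then \<open>n = U m + 1\<close>, where \<open>m\<close> is the shifted sum of the other
  terms, and \<open>d n = m + 1\<close>.
\<close>

text \<open>The heads of the arcs out of \<open>n\<close> form an interval above \<open>n\<close>,
  and \<open>jaco_indeg n \<le> n\<close> makes the truncated subtractions exact. For
  \<open>n = 0\<close>, not a vertex, this yields out-degree 0.\<close>

lemma out_degree_add_indeg: "out_degree jaco n + jaco_indeg n = n"
proof -
  have "card {i. 1 \<le> i \<and> i < n \<and> n + jaco_indeg i \<le> 2 * i} \<le> card {..<n}"
    by (intro card_mono) auto
  then have le: "jaco_indeg n \<le> n"
    by (simp add: jaco_indeg.simps [of n])
  have "out_arcs jaco n = (\<lambda>j. (n, j)) ` {n<..2 * n - jaco_indeg n}"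
    by (auto simp: out_arcs_def jaco_def)
  then have "out_degree jaco n = 2 * n - jaco_indeg n - n"
    by (simp add: out_degree_def card_image inj_on_def)
  with le show ?thesis
    by simp
qed

lemma out_degree_jaco_rec:
  "out_degree jaco n = card {k. k < n \<and> k + out_degree jaco k < n}"
proof -
  let ?A = "{k. 1 \<le> k \<and> k < n \<and> n + jaco_indeg k \<le> 2 * k}"
  let ?B = "{k. k < n \<and> k + out_degree jaco k < n}"
  have iff: "n + jaco_indeg k \<le> 2 * k \<longleftrightarrow> \<not> k + out_degree jaco k < n" for k
    using out_degree_add_indeg [of k] by linarith
  \<comment> \<open>The index 0 is excluded from \<open>?A\<close> but lies in \<open>?B\<close>
    when \<open>n > 0\<close>, since its out-degree is 0.\<close>
  have "?A \<union> ?B = {..<n}"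
    using out_degree_add_indeg [of 0] unfolding iff by (auto simp: Suc_le_eq intro: gr0I)
  moreover have "?A \<inter> ?B = {}"
    unfolding iff by auto
  ultimately have "card ?A + card ?B = n"
    by (subst card_Un_disjoint [symmetric]) auto
  then show ?thesis
    using out_degree_add_indeg [of n] by (simp add: jaco_indeg.simps [of n])
qed

lemma mono_out_degree_jaco: "mono (out_degree jaco)"
proof (rule monoI)
  fix m n :: nat
  assume "m \<le> n"
  then have "card {k. k < m \<and> k + out_degree jaco k < m}
      \<le> card {k. k < n \<and> k + out_degree jaco k < n}"
    by (intro card_mono) auto
  then show "out_degree jaco m \<le> out_degree jaco n"
    by (simp flip: out_degree_jaco_rec)
qed

lemma add_out_degree_less_iff:
  "k + out_degree jaco k < m + out_degree jaco m \<longleftrightarrow> k < m"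
proof -
  have "strict_mono (\<lambda>k. k + out_degree jaco k)"
    by (intro strict_monoI add_less_le_mono monoD [OF mono_out_degree_jaco]) auto
  then show ?thesis
    by (rule strict_mono_less)
qed

lemma out_degree_jaco_shift: "out_degree jaco (m + out_degree jaco m) = m"
proof -
  have "{k. k < m + out_degree jaco m \<and> k + out_degree jaco k < m + out_degree jaco m} = {..<m}"
    unfolding add_out_degree_less_iff by auto
  then show ?thesis
    by (subst out_degree_jaco_rec) simp
qed

lemma out_degree_jaco_Suc_shift: "out_degree jaco (Suc (m + out_degree jaco m)) = Suc m"
proof -
  have iff: "k + out_degree jaco k < Suc (m + out_degree jaco m) \<longleftrightarrow> k \<le> m" for k
    using add_out_degree_less_iff [of m k] by linarith
  have "{k. k < Suc (m + out_degree jaco m) \<and>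
      k + out_degree jaco k < Suc (m + out_degree jaco m)} = {..m}"
    unfolding iff by auto
  then show ?thesis
    by (subst out_degree_jaco_rec) simp
qed

text \<open>With index sets in place of sequences, shifting is taking an image. The induction is on
  the sum of the indices, which the shift lowers.\<close>

lemma out_degree_jaco_sum_fib:
  assumes "finite S" and "\<And>k. k \<in> S \<Longrightarrow> 2 \<le> k" and "\<And>k. k \<in> S \<Longrightarrow> Suc k \<notin> S"
  shows "out_degree jaco (\<Sum>k\<in>S. fib k) = (\<Sum>k\<in>S. fib (k - 1))"
  using assms
proof (induction "\<Sum>S" arbitrary: S rule: less_induct)
  case less
  \<comment> \<open>The index 2 would shift to 1, below the bound required by the induction
    hypothesis.\<close>
  define T where "T = S - {2}"
  have T3: "3 \<le> k" if "k \<in> T" for k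
    using that less.prems(2) [of k] by (auto simp: T_def)
  have fib_T: "fib k = fib (k - 1) + fib (k - 2)" if "k \<in> T" for k
  proof -
    have "k = Suc (Suc (k - 2))"
      using T3 [OF that] by simp
    then obtain j where "k = Suc (Suc j)" ..
    then show ?thesis
      by simp
  qed
  have inj: "inj_on (\<lambda>k. k - 1) T"
  proof (rule inj_onI)
    show "x = y" if "x \<in> T" "y \<in> T" "x - 1 = y - 1" for x y
      using T3 [of x] T3 [of y] that by simp
  qed
  let ?m = "\<Sum>k\<in>T. fib (k - 1)"
  have d_m: "out_degree jaco ?m = (\<Sum>k\<in>T. fib (k - 2))"
  \<comment> \<open>For empty \<open>T\<close> the index sum need not decrease, as \<open>S\<close>
    may be empty too.\<close>
  proof (cases "T = {}")
    case True
    then show ?thesis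
      using out_degree_add_indeg [of 0] by simp
  next
    case False
    let ?T' = "(\<lambda>k. k - 1) ` T"
    have "\<Sum>?T' = (\<Sum>k\<in>T. k - 1)"
      using inj by (simp add: sum.reindex)
    also have "\<dots> < \<Sum>T"
    proof (rule sum_strict_mono)
      show "k - 1 < k" if "k \<in> T" for k
        using T3 [OF that] by simp
    qed (use False less.prems(1) in \<open>simp_all add: T_def\<close>)
    also have "\<dots> \<le> \<Sum>S"
      using less.prems(1) by (intro sum_mono2) (auto simp: T_def)
    finally have "out_degree jaco (\<Sum>k\<in>?T'. fib k) = (\<Sum>k\<in>?T'. fib (k - 1))"
    proof (rule less.hyps)
      show "finite ?T'"
        using less.prems(1) by (simp add: T_def)
      show "2 \<le> k" if "k \<in> ?T'" for k
        using that T3 by fastforce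
      show "Suc k \<notin> ?T'" if k: "k \<in> ?T'" for k
      proof
        assume "Suc k \<in> ?T'"
        then have "Suc (Suc k) \<in> T"
          using T3 by force
        moreover have "Suc k \<in> T"
          using k T3 by force
        ultimately show False
          using less.prems(3) [of "Suc k"] by (simp add: T_def)
      qed
    qed
    then show ?thesis
      using inj by (simp add: sum.reindex numeral_2_eq_2)
  qed
  have shift: "(\<Sum>k\<in>T. fib k) = ?m + out_degree jaco ?m"
    unfolding d_m sum.distrib [symmetric] by (intro sum.cong refl fib_T)
  show ?case
  proof (cases "2 \<in> S")
    case True
    \<comment> \<open>The index 2 contributes 1 to both sums, because
      \<open>fib 2 = fib 1 = 1\<close>.\<close>
    have "(\<Sum>k\<in>S. fib k) = Suc (\<Sum>k\<in>T. fib k)" "(\<Sum>k\<in>S. fib (k - 1)) = Suc ?m"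
      using less.prems(1) True by (simp_all add: T_def sum.remove [of S 2] numeral_2_eq_2)
    then show ?thesis
      by (simp only: shift out_degree_jaco_Suc_shift)
  next
    case False
    then have "T = S"
      by (simp add: T_def)
    then show ?thesis
      using shift out_degree_jaco_shift [of ?m] by simp
  qed
qed

text \<open>Chaining the gaps between neighbours extends the bound to all pairs. This makes
  \<open>i\<close> injective on \<open>{1..r}\<close> and its values non-consecutive, so that sums
  over positions become sums over index sets.\<close>

lemma zeckendorf_rep_gap:
  assumes "zeckendorf_rep n r i" and "1 \<le> s" and "s < t" and "t \<le> r"
  shows "i t + 2 \<le> i s"
proof -
  have consecutive: "i (Suc s) + 2 \<le> i s" if "1 \<le> s" "s < r" for s
    using assms(1) that by (simp add: zeckendorf_rep_def)
  from \<open>s < t\<close> have "Suc s \<le> t"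
    by simp
  then show ?thesis
    using \<open>t \<le> r\<close>
  proof (induction t rule: dec_induct)
    case base
    then show ?case
      using consecutive [of s] \<open>1 \<le> s\<close> by simp
  next
    case (step t)
    show ?case
      using step consecutive [of t] \<open>1 \<le> s\<close> by simp
  qed
qed

theorem theorem3p1:
  fixes n r :: nat and i :: "nat \<Rightarrow> nat"
  assumes "n \<ge> 1"
    and "zeckendorf_rep n r i"
  shows "out_degree jaco n = (\<Sum>s = 1..r. fib (i s - 1))"
proof -
  note gap = zeckendorf_rep_gap [OF assms(2)]
  have last: "2 \<le> i r" and n: "n = (\<Sum>s = 1..r. fib (i s))"
    using assms(2) by (simp_all add: zeckendorf_rep_def)
  have inj: "inj_on i {1..r}"
  proof (rule linorder_inj_onI)
    show "i s \<noteq> i t" if "s < t" "s \<in> {1..r}" "t \<in> {1..r}" for s t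
      using gap [of s t] that by simp
  qed auto
  have "out_degree jaco (\<Sum>k\<in>i ` {1..r}. fib k) = (\<Sum>k\<in>i ` {1..r}. fib (k - 1))"
  proof (rule out_degree_jaco_sum_fib)
    show "2 \<le> k" if "k \<in> i ` {1..r}" for k
    proof -
      from that obtain s where "k = i s" "1 \<le> s" "s \<le> r"
        by auto
      then show ?thesis
        \<comment> \<open>The last index is the smallest, so its lower bound passes to all
          others.\<close>
        using gap [of s r] last by (cases "s = r") auto
    qed
    show "Suc k \<notin> i ` {1..r}" if "k \<in> i ` {1..r}" for k
    proof
      assume "Suc k \<in> i ` {1..r}"
      with that obtain s t where "k = i s" "Suc k = i t" "s \<in> {1..r}" "t \<in> {1..r}"
        by auto
      then show False
        using gap [of s t] gap [of t s] by (cases s t rule: linorder_cases) auto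
    qed
  qed simp
  then show ?thesis
    using inj by (simp add: sum.reindex n)
qed

end
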